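(* There is a dense open set $\mathcal G\subseteq C(\Omega)$ such that every $f\in\mathcal G$ satisfies $$\alpha_{f,\min}<\alpha_{f,\min}^*<\alpha_{f,\max}^*<\alpha_{f,\max}.$$ Hence the generic $f\in C(\Omega)$ satisfies these inequalities.
   Context: $\Omega=\{0,1\}^{\mathbb N}$ ($\mathbb N=\{1,2,\dots\}$) with the metric $d(\omega,\omega')=\sum_{k\ge1}|\omega_k-\omega'_k|2^{-k}$; $\sigma:\Omega\to\Omega$ is the one-sided shift, $(\sigma\omega)_k=\omega_{k+1}$. $C(\Omega)$ is the space of continuous functions $\Omega\to\mathbb R$ with the supremum norm. A property holds for the generic $f\in C(\Omega)$ if the set of $f$ having it is the complement of a set of first category (a countable union of nowhere dense sets) in $C(\Omega)$. For $f\in C(\Omega)$, $\alpha_{f,\max}=\max_\Omega f$ and $\alpha_{f,\min}=\min_\Omega f$. For $\alpha\in\mathbb R$, $E_f(\alpha)=\{\omega\in\Omega:\lim_{N\to\infty}\frac1N\sum_{n=1}^N f(\sigma^n\omega)=\alpha\}$; $\alpha_{f,\max}^*=\sup\{\alpha\in\mathbb R:E_f(\alpha)\ne\emptyset\}$ and $\alpha_{f,\min}^*=\inf\{\alpha\in\mathbb R:E_f(\alpha)\ne\emptyset\}$. *)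

theory Defs
  imports "HOL-Analysis.Analysis"
begin

text \<open>
  The one-sided full shift on two symbols.  The library already puts the product topology on
  \<^typ>\<open>nat \<Rightarrow> bool\<close>, so a copy of that type is used to carry the metric \<open>d\<close>.  The symbols
  0 and 1 are \<^term>\<open>False\<close> and \<^term>\<open>True\<close>, and positions are counted from 0: \<open>digit w k\<close> is the
  \<open>(k+1)\<close>-st symbol of the sequence.
\<close>

typedef omega = "UNIV :: (nat \<Rightarrow> bool) set"
  morphisms digit Omega ..

setup_lifting type_definition_omega

lemma digit_Omega [simp]: "digit (Omega x) = x"
  by (simp add: Omega_inverse)

lemma omega_eqI: "(\<And>k. digit x k = digit y k) \<Longrightarrow> x = y"
  by (simp add: fun_eq_iff flip: digit_inject)

instantiation omega :: metric_space
begin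

definition dist_omega :: "omega \<Rightarrow> omega \<Rightarrow> real" where
  "dist_omega x y = (\<Sum>k. \<bar>of_bool (digit x k) - of_bool (digit y k)\<bar> / 2 ^ Suc k)"

definition uniformity_omega :: "(omega \<times> omega) filter" where
  "uniformity_omega = (INF e\<in>{0<..}. principal {(x, y). dist x y < e})"

definition open_omega :: "omega set \<Rightarrow> bool" where
  "open_omega U = (\<forall>x\<in>U. \<forall>\<^sub>F (x', y) in uniformity. x' = x \<longrightarrow> y \<in> U)"

lemma summable_geometric_Suc: "summable (\<lambda>k. 1 / 2 ^ Suc k :: real)"
  using summable_mult[OF summable_geometric[of "1/2::real"], of "1/2"]
  by (simp add: power_divide)

lemma dist_omega_summable:
  "summable (\<lambda>k. \<bar>of_bool (digit x k) - of_bool (digit y k)\<bar> / 2 ^ Suc k :: real)"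
  by (rule summable_comparison_test'[OF summable_geometric_Suc, of 0])
     (auto simp: of_bool_def)

instance
proof
  fix x y z :: omega
  show "dist x y = 0 \<longleftrightarrow> x = y"
  proof
    assume "dist x y = 0"
    then have "\<forall>k. \<bar>of_bool (digit x k) - of_bool (digit y k)\<bar> / 2 ^ Suc k = (0::real)"
      unfolding dist_omega_def
      by (subst (asm) suminf_eq_zero_iff[OF dist_omega_summable]) auto
    then show "x = y"
      by (intro omega_eqI) (auto simp: of_bool_def split: if_splits)
  qed (simp add: dist_omega_def)
  show "dist x y \<le> dist x z + dist y z"
    unfolding dist_omega_def
    by (subst suminf_add[OF dist_omega_summable dist_omega_summable],
        rule suminf_le[OF _ dist_omega_summable summable_add[OF dist_omega_summable dist_omega_summable]])
       (auto simp: of_bool_def)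
qed (simp_all add: uniformity_omega_def open_omega_def)

end

text \<open>
  The space is compact, so the type \<open>omega \<Rightarrow>\<^sub>C real\<close> of bounded continuous functions with the
  supremum metric consists of all continuous functions.
\<close>

lemma continuous_on_Omega: "continuous_on UNIV Omega"
proof -
  have "(Omega \<longlongrightarrow> Omega x) (at x)" for x
  proof -
    let ?t = "\<lambda>k y. \<bar>of_bool (y k) - of_bool (x k)\<bar> / 2 ^ Suc k :: real"
    have c: "continuous_on UNIV (?t k)" for k
    proof -
      have "continuous_on UNIV (\<lambda>b. \<bar>of_bool b - of_bool (x k)\<bar> / 2 ^ Suc k :: real)"
        by simp
      from continuous_on_compose2[OF this continuous_on_product_coordinates[of k]]
      show ?thesis by simp
    qed
    have "uniform_limit UNIV (\<lambda>n y. \<Sum>k<n. ?t k y) (\<lambda>y. \<Sum>k. ?t k y) sequentially"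
      by (rule Weierstrass_m_test[OF _ summable_geometric_Suc]) (auto simp: of_bool_def)
    moreover have "\<forall>\<^sub>F n in sequentially. continuous_on UNIV (\<lambda>y. \<Sum>k<n. ?t k y)"
      by (intro always_eventually allI continuous_on_sum c)
    ultimately have "continuous_on UNIV (\<lambda>y. \<Sum>k. ?t k y)"
      by (intro uniform_limit_theorem) auto
    then have "((\<lambda>y. \<Sum>k. ?t k y) \<longlongrightarrow> (\<Sum>k. ?t k x)) (at x)"
      by (auto simp only: continuous_on)
    moreover have "(\<Sum>k. ?t k x) = 0" by simp
    ultimately show ?thesis
      unfolding tendsto_dist_iff[of Omega] by (simp add: dist_omega_def)
  qed
  then show ?thesis by (simp add: continuous_on)
qed

lemma compact_UNIV_omega: "compact (UNIV :: omega set)"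
proof -
  have "compact_space (euclidean :: bool topology)"
    by (simp add: compact_space_def finite_imp_compact)
  then have "compact_space (euclidean :: (nat \<Rightarrow> bool) topology)"
    by (simp add: compact_space_product_topology flip: euclidean_product_topology)
  then have "compact (UNIV :: (nat \<Rightarrow> bool) set)"
    by (simp add: compact_space_def)
  from compact_continuous_image[OF continuous_on_Omega this] show ?thesis
    by (metis UNIV_I digit_inverse surjI)
qed

lemma continuous_imp_bcontfun:
  fixes f :: "omega \<Rightarrow> real"
  assumes "continuous_on UNIV f"
  shows "f \<in> bcontfun"
  using assms compact_continuous_image[OF assms compact_UNIV_omega]
  by (simp add: bcontfun_def compact_imp_bounded)

lift_definition shift :: "omega \<Rightarrow> omega" is "\<lambda>x k. x (Suc k)" .

definition alpha_max :: "(omega \<Rightarrow>\<^sub>C real) \<Rightarrow> real" where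
  "alpha_max f = (GREATEST a. a \<in> range (apply_bcontfun f))"

definition alpha_min :: "(omega \<Rightarrow>\<^sub>C real) \<Rightarrow> real" where
  "alpha_min f = (LEAST a. a \<in> range (apply_bcontfun f))"

lemma alpha_max_attained: "\<exists>x. alpha_max f = f x" "f x \<le> alpha_max f"
proof -
  obtain z where z: "\<And>y. f y \<le> f z"
    using continuous_attains_sup[OF compact_UNIV_omega, of f] by auto
  then have "alpha_max f = f z"
    unfolding alpha_max_def by (intro Greatest_equality) auto
  with z show "\<exists>x. alpha_max f = f x" "f x \<le> alpha_max f" by auto
qed

lemma alpha_min_attained: "\<exists>x. alpha_min f = f x" "alpha_min f \<le> f x"
proof -
  obtain z where z: "\<And>y. f z \<le> f y"
    using continuous_attains_inf[OF compact_UNIV_omega, of f] by auto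
  then have "alpha_min f = f z"
    unfolding alpha_min_def by (intro Least_equality) auto
  with z show "\<exists>x. alpha_min f = f x" "alpha_min f \<le> f x" by auto
qed

definition birkhoff_level :: "(omega \<Rightarrow>\<^sub>C real) \<Rightarrow> real \<Rightarrow> omega set" where
  "birkhoff_level f a =
     {x. (\<lambda>N. 1 / real N * (\<Sum>n=1..N. f ((shift ^^ n) x))) \<longlonglongrightarrow> a}"

definition alpha_max_star :: "(omega \<Rightarrow>\<^sub>C real) \<Rightarrow> real" where
  "alpha_max_star f = Sup {a. birkhoff_level f a \<noteq> {}}"

definition alpha_min_star :: "(omega \<Rightarrow>\<^sub>C real) \<Rightarrow> real" where
  "alpha_min_star f = Inf {a. birkhoff_level f a \<noteq> {}}"

text \<open>
  \<^const>\<open>Sup\<close> and \<^const>\<open>Inf\<close> on the reals are meaningful only for nonempty sets bounded on the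
  relevant side, which is the case here.
\<close>

lemma birkhoff_level_nonempty: "{a. birkhoff_level f a \<noteq> {}} \<noteq> {}"
proof -
  let ?z = "Omega (\<lambda>_. False)"
  have "shift ?z = ?z" by (rule omega_eqI) (simp add: shift.rep_eq)
  then have "(shift ^^ n) ?z = ?z" for n by (induction n) auto
  then have "(\<lambda>N. 1 / real N * (\<Sum>n=1..N. f ((shift ^^ n) ?z))) = (\<lambda>N. if N = 0 then 0 else f ?z)"
    by auto
  moreover have "\<dots> \<longlonglongrightarrow> f ?z"
    by (rule tendsto_eventually) (auto simp: eventually_sequentially intro!: exI[of _ 1])
  ultimately have "?z \<in> birkhoff_level f (f ?z)" by (simp add: birkhoff_level_def)
  then show ?thesis by blast
qed

lemma birkhoff_level_bounds:
  assumes "birkhoff_level f a \<noteq> {}"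
  shows "alpha_min f \<le> a" "a \<le> alpha_max f"
proof -
  obtain x where x: "(\<lambda>N. 1 / real N * (\<Sum>n=1..N. f ((shift ^^ n) x))) \<longlonglongrightarrow> a"
    using assms by (auto simp: birkhoff_level_def)
  have up: "1 / real N * (\<Sum>n=1..N. f ((shift ^^ n) x)) \<le> alpha_max f" if "N \<ge> 1" for N
    using that sum_bounded_above[of "{1..N}" "\<lambda>n. f ((shift ^^ n) x)" "alpha_max f"]
    by (simp add: alpha_max_attained(2) field_simps)
  have lo: "alpha_min f \<le> 1 / real N * (\<Sum>n=1..N. f ((shift ^^ n) x))" if "N \<ge> 1" for N
    using that sum_bounded_below[of "{1..N}" "alpha_min f" "\<lambda>n. f ((shift ^^ n) x)"]
    by (simp add: alpha_min_attained(2) field_simps)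
  show "alpha_min f \<le> a" using LIMSEQ_le_const[OF x] lo by blast
  show "a \<le> alpha_max f" using LIMSEQ_le_const2[OF x] up by blast
qed

lemma birkhoff_level_bdd:
  "bdd_above {a. birkhoff_level f a \<noteq> {}}" "bdd_below {a. birkhoff_level f a \<noteq> {}}"
  unfolding bdd_above_def bdd_below_def
  using birkhoff_level_bounds[of f] by blast+

definition nowhere_dense :: "'a::topological_space set \<Rightarrow> bool" where
  "nowhere_dense A \<longleftrightarrow> interior (closure A) = {}"

definition first_category :: "'a::topological_space set \<Rightarrow> bool" where
  "first_category A \<longleftrightarrow> (\<exists>F. countable F \<and> (\<forall>B\<in>F. nowhere_dense B) \<and> A = \<Union>F)"

definition generic :: "('a::topological_space \<Rightarrow> bool) \<Rightarrow> bool" where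
  "generic P \<longleftrightarrow> (\<exists>A. first_category A \<and> {x. P x} = - A)"

end

theory Submission
  imports Defs
begin

text \<open>
  If \<open>f y + f (\<sigma> y) \<le> 2 c\<close> for all \<open>y\<close>, then every limit of Birkhoff averages of \<open>f\<close> is at most
  \<open>c\<close>; so \<open>\<alpha>\<^sup>*\<^sub>m\<^sub>a\<^sub>x < \<alpha>\<^sub>m\<^sub>a\<^sub>x\<close> as soon as moreover \<open>c < f x\<close> for some \<open>x\<close>, and this condition is open.
  It is also dense: pick a point \<open>p\<close> that is not fixed by \<open>\<sigma>\<close> and at which \<open>f\<close> almost attains its
  maximum, and add to \<open>f\<close> a small bump supported so close to \<open>p\<close> that no orbit visits the support
  twice in a row.  The bump raises the maximum by its full height, but averages over two
  consecutive times by at most about half of it.  The minimum is treated by passing to \<open>-f\<close>, and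
  the middle inequality holds when \<open>f\<close> separates the two fixed points of \<open>\<sigma>\<close>.
\<close>

section \<open>The metric, the shift and its fixed points\<close>

lemma dist_omega_shift: "dist (shift x) (shift y) \<le> 2 * dist x y"
proof -
  let ?t = "\<lambda>k. \<bar>of_bool (digit x k) - of_bool (digit y k)\<bar> / 2 ^ Suc k :: real"
  have "dist x y = (\<Sum>k. ?t (Suc k)) + ?t 0"
    unfolding dist_omega_def using suminf_split_head[OF dist_omega_summable[of x y]] by simp
  moreover have "dist (shift x) (shift y) = 2 * (\<Sum>k. ?t (Suc k))"
  proof -
    have "summable (\<lambda>k. ?t (Suc k))"
      using dist_omega_summable[of x y] by (subst summable_Suc_iff)
    from suminf_mult[OF this, of 2] show ?thesis
      by (simp add: dist_omega_def shift.rep_eq)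
  qed
  ultimately show ?thesis by simp
qed

lemma dist_omega_upd: "dist (Omega ((digit x)(k := b))) x \<le> 1 / 2 ^ Suc k"
proof -
  let ?t = "\<lambda>i. \<bar>of_bool (((digit x)(k := b)) i) - of_bool (digit x i)\<bar> / 2 ^ Suc i :: real"
  have "(\<Sum>i. ?t i) = (\<Sum>i\<in>{k}. ?t i)"
    by (rule suminf_finite) auto
  then show ?thesis by (simp add: dist_omega_def of_bool_def)
qed

text \<open>A fixed point is a constant sequence. Flipping its symbol at a far position
  \<open>k\<close> moves it very little, and the symbols at \<open>k\<close> and
  \<open>Suc k\<close> then differ.\<close>

lemma exists_nonfixed_near:
  assumes "e > 0"
  shows "\<exists>p. dist p x < e \<and> shift p \<noteq> p"
proof (cases "shift x = x")
  case True
  obtain k where k: "(1/2) ^ k < e"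
    using real_arch_pow_inv[OF assms, of "1/2"] by auto
  let ?p = "Omega ((digit x)(k := \<not> digit x k))"
  have "1 / 2 ^ Suc k \<le> (1/2 :: real) ^ k" by (simp add: power_divide field_simps)
  with dist_omega_upd[of x k "\<not> digit x k"] k have "dist ?p x < e" by linarith
  moreover have "digit x (Suc k) = digit x k"
    using True by (metis shift.rep_eq)
  then have "digit (shift ?p) k \<noteq> digit ?p k"
    by (simp add: shift.rep_eq)
  then have "shift ?p \<noteq> ?p" by metis
  ultimately show ?thesis by blast
next
  case False
  with assms show ?thesis by (intro exI[of _ x]) auto
qed

section \<open>Tent functions\<close>

definition bump :: "omega \<Rightarrow> real \<Rightarrow> real \<Rightarrow> omega \<Rightarrow>\<^sub>C real" where
  "bump p r h = Bcontfun (\<lambda>x. h * max 0 (1 - dist x p / r))"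

lemma apply_bump: "bump p r h x = h * max 0 (1 - dist x p / r)"
proof -
  have "continuous_on UNIV (\<lambda>x. h * max 0 (1 - dist x p / r))"
    by (auto simp: divide_inverse intro!: continuous_intros)
  then show ?thesis
    by (simp add: bump_def Bcontfun_inverse continuous_imp_bcontfun)
qed

lemma bump_center [simp]: "bump p r h p = h"
  by (simp add: apply_bump)

lemma bump_bounds:
  assumes "0 < r" "0 \<le> h"
  shows "0 \<le> bump p r h x" "bump p r h x \<le> h"
  using assms by (auto simp: apply_bump intro!: mult_left_le)

lemma bump_outside: "0 < r \<Longrightarrow> r \<le> dist x p \<Longrightarrow> bump p r h x = 0"
  by (simp add: apply_bump max_def)

lemma dist_add_bump:
  assumes "0 < r" "0 \<le> h"
  shows "dist (f + bump p r h) f \<le> h"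
proof -
  have "norm (bump p r h) \<le> h"
    using bump_bounds[OF assms] by (intro norm_bound) simp
  then show ?thesis by (simp add: dist_norm)
qed

section \<open>The open dense condition at the maximum\<close>

definition two_step_max :: "(omega \<Rightarrow>\<^sub>C real) set" where
  "two_step_max = {f :: omega \<Rightarrow>\<^sub>C real. \<exists>x c. c < f x \<and> (\<forall>y. f y + f (shift y) \<le> 2 * c)}"

lemma open_two_step_max: "open two_step_max"
  unfolding open_dist
proof
  fix f assume "f \<in> two_step_max"
  then obtain x c where xc: "c < f x" "\<And>y. f y + f (shift y) \<le> 2 * c"
    unfolding two_step_max_def by blast
  \<comment> \<open>With a third of the gap, \<open>c + d\<close> serves as the new constant:
    \<open>g x\<close> stays above \<open>c + 2 * d\<close>, while two-step sums of \<open>g\<close>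
    stay below \<open>2 * (c + d)\<close>.\<close>
  define d where "d = (f x - c) / 3"
  have "g \<in> two_step_max" if "dist g f < d" for g
  proof -
    have b: "\<bar>g y - f y\<bar> < d" for y
      using dist_bounded[of g y f] that by (simp add: dist_real_def)
    have "f x = c + 3 * d" by (simp add: d_def field_simps)
    with b[of x] have "c + d < g x" using xc(1) by linarith
    moreover have "g y + g (shift y) \<le> 2 * (c + d)" for y
      using b[of y] b[of "shift y"] xc(2)[of y] by (simp add: abs_less_iff)
    ultimately show ?thesis unfolding two_step_max_def by blast
  qed
  moreover have "d > 0" using xc by (simp add: d_def)
  ultimately show "\<exists>e>0. \<forall>g. dist g f < e \<longrightarrow> g \<in> two_step_max" by blast
qed

lemma closure_two_step_max: "closure two_step_max = UNIV"
proof -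
  have "\<exists>g\<in>two_step_max. dist g f < e" if "e > 0" for f :: "omega \<Rightarrow>\<^sub>C real" and e
  proof -
    \<comment> \<open>The bump will have height \<open>3 * h < e\<close>. Since
      \<open>f p > f x - h\<close>, it lifts the value at \<open>p\<close> above
      \<open>f x + 2 * h\<close>, whereas two-step averages reach at most
      \<open>f x + 3 / 2 * h\<close>.\<close>
    define h where "h = e / 4"
    have h: "h > 0" using that by (simp add: h_def)
    obtain x where x: "\<And>y. f y \<le> f x"
      using alpha_max_attained by metis
    have "continuous_on UNIV f" by simp
    then obtain s where s: "s > 0" "\<And>y. dist y x < s \<Longrightarrow> dist (f y) (f x) < h"
      using h unfolding continuous_on_iff by (metis UNIV_I)
    obtain p where p: "dist p x < s" "shift p \<noteq> p"
      using exists_nonfixed_near[OF s(1)] by blast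
    \<comment> \<open>If \<open>y\<close> and \<open>shift y\<close> were both within
      \<open>r\<close> of \<open>p\<close>, then \<open>shift p\<close> would be closer to
      \<open>p\<close> than \<open>2 * r + r\<close>, because \<open>shift\<close> at most doubles
      distances.\<close>
    define r where "r = dist (shift p) p / 3"
    have r: "r > 0" using p by (simp add: r_def)
    define g where "g = f + bump p r (3 * h)"
    have "f x - h < f p"
      using s(2)[OF p(1)] by (simp add: dist_real_def abs_less_iff)
    then have "f x + 3 / 2 * h < g p"
      using h by (simp add: g_def)
    moreover have "g y + g (shift y) \<le> 2 * (f x + 3 / 2 * h)" for y
    proof -
      have "r \<le> dist y p \<or> r \<le> dist (shift y) p"
        using dist_omega_shift[of p y] dist_triangle[of "shift p" p "shift y"]
        by (auto simp: r_def dist_commute)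
      then have "bump p r (3 * h) y + bump p r (3 * h) (shift y) \<le> 3 * h"
        using bump_outside[OF r] bump_bounds(2)[OF r, of "3 * h"] h by fastforce
      with x[of y] x[of "shift y"] show ?thesis by (simp add: g_def)
    qed
    ultimately have "g \<in> two_step_max" unfolding two_step_max_def by blast
    moreover have "dist g f < e"
      using dist_add_bump[OF r, of "3 * h" f p] h by (simp add: g_def h_def)
    ultimately show ?thesis by blast
  qed
  then show ?thesis by (auto simp: closure_approachable)
qed

section \<open>Limits of Birkhoff averages\<close>

lemma birkhoff_level_le:
  fixes f :: "omega \<Rightarrow>\<^sub>C real"
  assumes c: "\<And>y. f y + f (shift y) \<le> 2 * c" and "birkhoff_level f a \<noteq> {}"
  shows "a \<le> c"
proof -
  obtain x where x: "(\<lambda>N. 1 / real N * (\<Sum>n=1..N. f ((shift ^^ n) x))) \<longlonglongrightarrow> a"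
    using assms by (auto simp: birkhoff_level_def)
  let ?S = "\<lambda>N. \<Sum>n=1..N. f ((shift ^^ n) x)"
  define C where "C = alpha_max f - alpha_min f"
  \<comment> \<open>Adding the hypothesis along the orbit counts each term twice except the two at
    the ends. These boundary terms are bounded by \<open>C\<close> and vanish after division by
    \<open>N\<close>.\<close>
  have S: "2 * ?S N \<le> 2 * (c * N) + f (shift x) - f ((shift ^^ Suc N) x)" for N
  proof (induction N)
    case (Suc N)
    show ?case using Suc c[of "(shift ^^ Suc N) x"] by (simp add: algebra_simps)
  qed simp
  have "1 / real N * ?S N \<le> c + C / 2 * inverse (real N)" if "N \<ge> 1" for N
  proof -
    have "2 * ?S N \<le> 2 * (c * N) + C"
      using S[of N] alpha_max_attained(2)[of f "shift x"]
        alpha_min_attained(2)[of f "(shift ^^ Suc N) x"] unfolding C_def by argo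
    then show ?thesis using that by (simp add: field_simps)
  qed
  moreover have "(\<lambda>N. c + C / 2 * inverse (real N)) \<longlonglongrightarrow> c + C / 2 * 0"
    by (intro tendsto_intros lim_inverse_n)
  ultimately show ?thesis
    using LIMSEQ_le[OF x, of "\<lambda>N. c + C / 2 * inverse (real N)" c] by auto
qed

lemma alpha_max_star_less:
  assumes "f \<in> two_step_max"
  shows "alpha_max_star f < alpha_max f"
proof -
  obtain x c where xc: "c < f x" "\<And>y. f y + f (shift y) \<le> 2 * c"
    using assms unfolding two_step_max_def by blast
  have "alpha_max_star f \<le> c"
    unfolding alpha_max_star_def
    using birkhoff_level_nonempty birkhoff_level_le[OF xc(2)] by (intro cSup_least) auto
  with xc(1) alpha_max_attained(2)[of f x] show ?thesis by linarith
qed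

section \<open>Exchanging maximum and minimum\<close>

lemma birkhoff_level_uminus: "birkhoff_level (- f) a = birkhoff_level f (- a)"
proof -
  have "(\<lambda>N. 1 / real N * (\<Sum>n=1..N. (- f) ((shift ^^ n) x)))
      = (\<lambda>N. - (1 / real N * (\<Sum>n=1..N. f ((shift ^^ n) x))))" for x
    by (simp add: sum_negf)
  then show ?thesis
    unfolding birkhoff_level_def by (simp only: tendsto_minus_cancel_left)
qed

lemma alpha_min_star_uminus: "alpha_min_star f = - alpha_max_star (- f)"
proof -
  have "{a. birkhoff_level (- f) a \<noteq> {}} = uminus ` {a. birkhoff_level f a \<noteq> {}}"
    unfolding birkhoff_level_uminus by (auto intro: image_eqI[of _ _ "- _"])
  \<comment> \<open>On the reals, \<open>Inf\<close> is by definition minus the \<open>Sup\<close>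
    of the negated set.\<close>
  then show ?thesis
    by (simp add: alpha_min_star_def alpha_max_star_def Inf_real_def)
qed

lemma alpha_min_uminus: "alpha_min f = - alpha_max (- f)"
proof (rule antisym)
  show "alpha_min f \<le> - alpha_max (- f)"
    using alpha_max_attained(1)[of "- f"] alpha_min_attained(2)[of f] by auto
  obtain x where "alpha_min f = f x" using alpha_min_attained(1)[of f] by auto
  with alpha_max_attained(2)[of "- f" x] show "- alpha_max (- f) \<le> alpha_min f" by simp
qed

section \<open>Separating the two fixed points\<close>

abbreviation zeros :: omega where "zeros \<equiv> Omega (\<lambda>_. False)"
abbreviation ones :: omega where "ones \<equiv> Omega (\<lambda>_. True)"

lemma zeros_neq_ones: "zeros \<noteq> ones"
  by (metis digit_Omega)

definition separating :: "(omega \<Rightarrow>\<^sub>C real) set" where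
  "separating = {f :: omega \<Rightarrow>\<^sub>C real. f zeros \<noteq> f ones}"

lemma open_separating: "open separating"
proof -
  \<comment> \<open>Evaluation at a point is 1-Lipschitz for the supremum metric.\<close>
  have "continuous_on UNIV (\<lambda>f :: omega \<Rightarrow>\<^sub>C real. f x)" for x
    unfolding continuous_on_iff by (auto intro: le_less_trans[OF dist_bounded])
  then show ?thesis
    unfolding separating_def by (intro open_Collect_neq)
qed

lemma closure_separating: "closure separating = UNIV"
proof -
  have "\<exists>g\<in>separating. dist g f < e" if "e > 0" for f e
  proof (cases "f \<in> separating")
    case True
    with that show ?thesis by (intro bexI[of _ f]) auto
  next
    case False
    \<comment> \<open>With this radius the bump at \<open>zeros\<close> vanishes at
      \<open>ones\<close>, so only one of the two equal values changes.\<close>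
    let ?r = "dist ones zeros"
    let ?g = "f + bump zeros ?r (e / 2)"
    have r: "?r > 0" using zeros_neq_ones by auto
    have "?g \<in> separating"
      using False that bump_outside[OF r order_refl, of "e / 2"] by (simp add: separating_def)
    moreover have "dist ?g f < e"
      using dist_add_bump[OF r, of "e / 2" f zeros] that by simp
    ultimately show ?thesis by blast
  qed
  then show ?thesis by (auto simp: closure_approachable)
qed

lemma birkhoff_level_fixed:
  assumes "shift z = z"
  shows "z \<in> birkhoff_level f (f z)"
proof -
  have "(shift ^^ n) z = z" for n using assms by (induction n) auto
  \<comment> \<open>At \<open>N = 0\<close> the average is 0, since division by zero gives
    0.\<close>
  then have "1 / real N * (\<Sum>n=1..N. f ((shift ^^ n) z)) = f z" if "N \<ge> 1" for N
    using that by simp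
  then show ?thesis
    unfolding birkhoff_level_def
    by (auto intro!: tendsto_eventually eventually_sequentiallyI[of 1])
qed

lemma alpha_star_fixed:
  assumes "shift z = z"
  shows "alpha_min_star f \<le> f z" "f z \<le> alpha_max_star f"
  unfolding alpha_min_star_def alpha_max_star_def
  using birkhoff_level_fixed[OF assms, of f] birkhoff_level_bdd[of f]
  by (auto intro!: cInf_lower cSup_upper)

text \<open>The averages at a fixed point converge to the value of \<open>f\<close> there, so two
  distinct numbers lie between the infimum and the supremum.\<close>

lemma alpha_min_star_less_alpha_max_star:
  assumes "f \<in> separating"
  shows "alpha_min_star f < alpha_max_star f"
proof -
  have "shift zeros = zeros" "shift ones = ones"
    by (auto intro!: omega_eqI simp: shift.rep_eq)
  from this[THEN alpha_star_fixed(1), of f] this[THEN alpha_star_fixed(2), of f] assms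
  show ?thesis by (auto simp: separating_def)
qed

section \<open>Density and category\<close>

lemma closure_Int_open_dense:
  assumes "open S" "closure S = UNIV" "closure T = UNIV"
  shows "closure (S \<inter> T) = UNIV"
proof -
  have "S \<subseteq> closure (S \<inter> T)"
    using open_Int_closure_subset[OF assms(1), of T] assms(3) by simp
  then have "closure S \<subseteq> closure (S \<inter> T)" by (rule closure_minimal) simp
  with assms(2) show ?thesis by auto
qed

lemma closure_negations_UNIV:
  fixes S :: "'a::real_normed_vector set"
  assumes "closure S = UNIV"
  shows "closure (uminus ` S) = UNIV"
proof -
  have "\<exists>y\<in>S. dist y (- x) < e" if "e > 0" for x e
    using assms that by (metis UNIV_I closure_approachable)
  then show ?thesis
    by (auto simp: closure_approachable) (metis dist_minus minus_minus)
qed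

text \<open>The exceptional set lies in the closed set \<open>- G\<close>, which has empty interior.
  It is thus itself nowhere dense, and a one-element family is enough.\<close>

lemma generic_if_open_dense:
  fixes G :: "'a::topological_space set"
  assumes "open G" "closure G = UNIV" "\<And>x. x \<in> G \<Longrightarrow> P x"
  shows "generic P"
proof -
  have "closure {x. \<not> P x} \<subseteq> - G"
    using assms(1,3) by (intro closure_minimal) auto
  then have "interior (closure {x. \<not> P x}) \<subseteq> interior (- G)"
    by (rule interior_mono)
  also have "\<dots> = {}" using assms(2) by (simp add: interior_complement)
  finally have "first_category {x. \<not> P x}"
    unfolding first_category_def nowhere_dense_def
    by (intro exI[of _ "{{x. \<not> P x}}"]) auto
  then show ?thesis
    unfolding generic_def by (intro exI[of _ "{x. \<not> P x}"]) auto
qed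

theorem theorem4p3p1:
  shows "(\<exists>G :: (omega \<Rightarrow>\<^sub>C real) set. open G \<and> closure G = UNIV \<and>
            (\<forall>f\<in>G. alpha_min f < alpha_min_star f \<and>
                   alpha_min_star f < alpha_max_star f \<and>
                   alpha_max_star f < alpha_max f)) \<and>
         generic (\<lambda>f :: omega \<Rightarrow>\<^sub>C real.
            alpha_min f < alpha_min_star f \<and>
            alpha_min_star f < alpha_max_star f \<and>
            alpha_max_star f < alpha_max f)"
proof -
  let ?P = "\<lambda>f :: omega \<Rightarrow>\<^sub>C real. alpha_min f < alpha_min_star f \<and>
      alpha_min_star f < alpha_max_star f \<and> alpha_max_star f < alpha_max f"
  let ?M = "uminus ` two_step_max"
  let ?G = "two_step_max \<inter> (?M \<inter> separating)"
  have M: "open ?M" "closure ?M = UNIV"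
    using open_two_step_max closure_two_step_max by (metis open_negations closure_negations_UNIV)+
  have o: "open ?G"
    using open_two_step_max M(1) open_separating by (intro open_Int)
  have d: "closure ?G = UNIV"
    using open_two_step_max closure_two_step_max M closure_separating
    by (intro closure_Int_open_dense)
  have P: "?P f" if "f \<in> ?G" for f
  proof -
    have "- f \<in> two_step_max" using that by auto
    from alpha_max_star_less[OF this] have "alpha_min f < alpha_min_star f"
      by (simp add: alpha_min_uminus[of f] alpha_min_star_uminus[of f])
    with that show ?thesis
      using alpha_max_star_less alpha_min_star_less_alpha_max_star by auto
  qed
  from o d P generic_if_open_dense[OF o d, of ?P] show ?thesis by blast
qed

end
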